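(* Let $\mathbb{F}$ be a field, let $X$ be a vector space over $\mathbb{F}$, and let $\lambda, \mu\in\mathbb{F}\setminus\{0\}$ be arbitrarily fixed. Then a function $f\colon\mathbb{F}\to X$ is a derivation if and only if \[ \lambda\left[f(x+y)-f(x)-f(y)\right]+\mu\left[f(xy)-xf(y)-yf(x)\right]=0 \] holds for all $x, y\in\mathbb{F}$.
   Context: A function $f\colon\mathbb{F}\to X$ is called a derivation if it is additive, i.e. $f(x+y)=f(x)+f(y)$ for all $x,y\in\mathbb{F}$, and also satisfies $f(xy)=xf(y)+yf(x)$ for all $x,y\in\mathbb{F}$, where $x\,f(y)$ denotes multiplication of the vector $f(y)\in X$ by the scalar $x\in\mathbb{F}$. *)

theory Defs
  imports Complex_Main
begin

definition derivation ::
  "('a::field \<Rightarrow> 'b::ab_group_add \<Rightarrow> 'b) \<Rightarrow> ('a \<Rightarrow> 'b) \<Rightarrow> bool"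
where
  "derivation scale f \<longleftrightarrow>
     (\<forall>x y. f (x + y) = f x + f y) \<and>
     (\<forall>x y. f (x * y) = scale x (f y) + scale y (f x))"

end

theory Submission
  imports Defs
begin

text \<open>
  Only the implication from the single equation to additivity and the Leibniz rule needs an
  argument. Dividing by \<open>l\<close> brings the equation to the form \<open>A x y + c M x y = 0\<close> with \<open>c \<noteq> 0\<close>,
  where \<open>A x y = f (x + y) - f x - f y\<close> and \<open>M x y = f (x y) - x f y - y f x\<close> measure the failure
  of the two laws; if one of them vanishes, so does the other.

  The key is that \<open>f\<close> vanishes at \<open>1\<close> (lemma \<open>mixed_equation_one\<close>). The substitution \<open>y = 1\<close> then
  gives \<open>f (x + 1) = f x\<close>, so that \<open>A x (y + 1) = A x y\<close> and therefore \<open>M x (y + 1) = M x y\<close>.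
  Written out, the latter is \<open>f (x y + x) = f (x y) + f x\<close>, and for \<open>x \<noteq> 0\<close> the product \<open>x y\<close> is an
  arbitrary element of the field: \<open>f\<close> is additive.
\<close>

context vector_space
begin

lemma mixed_equation_zero:
  assumes E: "\<And>x y. f (x + y) - f x - f y + scale c (f (x * y) - scale x (f y) - scale y (f x)) = 0"
  shows "f 0 = 0"
  using E[of 0 1] by simp

lemma mixed_equation_shift:
  assumes E: "\<And>x y. f (x + y) - f x - f y + scale c (f (x * y) - scale x (f y) - scale y (f x)) = 0"
  shows "f (x + 1) = f x + scale (1 + c * x) (f 1)"
  using E[of x 1] by (simp add: algebra_simps)

text \<open>
  The shift formula expresses \<open>f (-1)\<close> and \<open>f (-2)\<close> as multiples of \<open>f 1\<close>, and the equation at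
  \<open>x = y = -1\<close> then becomes \<open>2 c\<^sup>2 f 1 = 0\<close>. This settles every characteristic but \<open>2\<close>, where
  \<open>-1 = 1\<close> turns the expression \<open>f (-1) = (c - 1) f 1\<close> itself into \<open>c f 1 = 2 f 1 = 0\<close>.
\<close>

lemma mixed_equation_one:
  assumes c: "c \<noteq> 0"
    and E: "\<And>x y. f (x + y) - f x - f y + scale c (f (x * y) - scale x (f y) - scale y (f x)) = 0"
  shows "f 1 = 0"
proof -
  note shift = mixed_equation_shift[of f c, OF E]
  have m1: "f (- 1) = scale (c - 1) (f 1)"
    using shift[of "- 1"] mixed_equation_zero[of f c, OF E]
    by (simp add: algebra_simps eq_neg_iff_add_eq_0)
  show ?thesis
  proof (cases "(2::'a) = 0")
    case True
    then have "(- 1 :: 'a) = 1"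
      by (metis add_eq_0_iff one_add_one)
    then have "f 1 = scale (c - 1) (f 1)"
      using m1 by metis
    then have "scale ((c - 1) - 1) (f 1) = 0"
      unfolding scale_left_diff_distrib[of "c - 1"] by simp
    moreover have "(c - 1) - 1 = c"
      using True by simp
    ultimately show ?thesis
      using c by simp
  next
    case False
    have "f (- 1) = f (- 2) + scale (1 - 2 * c) (f 1)"
      using shift[of "- 2"] by (simp add: mult.commute)
    then have "f (- 2) = scale ((c - 1) - (1 - 2 * c)) (f 1)"
      unfolding m1 scale_left_diff_distrib[of "c - 1"] by (simp add: eq_diff_eq)
    moreover have "(c - 1) - (1 - 2 * c) = 3 * c - 2"
      by (simp add: algebra_simps)
    ultimately have m2: "f (- 2) = scale (3 * c - 2) (f 1)"
      by simp
    have "scale (3 * c - 2) (f 1) - scale (c - 1) (f 1) - scale (c - 1) (f 1)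
        + scale c (scale 1 (f 1) - scale (1 - c) (f 1) - scale (1 - c) (f 1)) = 0"
      using E[of "- 1" "- 1"] m1 m2 by simp
    then have "scale ((3 * c - 2) - (c - 1) - (c - 1) + c * (1 - (1 - c) - (1 - c))) (f 1) = 0"
      by (simp only: scale_left_diff_distrib[symmetric] scale_left_distrib[symmetric] scale_scale)
    moreover have "(3 * c - 2) - (c - 1) - (c - 1) + c * (1 - (1 - c) - (1 - c)) = 2 * c * c"
      by (simp add: algebra_simps)
    ultimately show ?thesis
      using False c by simp
  qed
qed

lemma mixed_equation_additive:
  assumes c: "c \<noteq> 0"
    and E: "\<And>x y. f (x + y) - f x - f y + scale c (f (x * y) - scale x (f y) - scale y (f x)) = 0"
  shows "f (x + y) = f x + f y"
proof (cases "x = 0")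
  case True
  then show ?thesis
    using mixed_equation_zero[of f c, OF E] by simp
next
  case False
  have periodic: "f (z + 1) = f z" for z
    using mixed_equation_shift[of f c, OF E] mixed_equation_one[of c f, OF c E] by simp
  define z where "z = y / x"
  have xz: "x * z = y"
    using False by (simp add: z_def)
  have "f (x + (z + 1)) = f (x + z)"
    using periodic[of "x + z"] by (simp add: add.assoc)
  then have "scale c (f (x * (z + 1)) - scale x (f (z + 1)) - scale (z + 1) (f x))
           = scale c (f (x * z) - scale x (f z) - scale z (f x))"
    using E[of x "z + 1"] E[of x z] periodic[of z] by (metis add_left_cancel)
  then have "f (x * (z + 1)) - scale x (f (z + 1)) - scale (z + 1) (f x)
           = f (x * z) - scale x (f z) - scale z (f x)"
    using c by simp
  then have "f (x * z + x) = f (x * z) + f x"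
    unfolding periodic by (simp add: algebra_simps)
  then show ?thesis
    by (simp add: xz add.commute)
qed

end

theorem corollary2p3:
  fixes scale :: "'a::field \<Rightarrow> 'b::ab_group_add \<Rightarrow> 'b"
    and l m :: 'a
    and f :: "'a \<Rightarrow> 'b"
  assumes "vector_space scale"
    and "l \<noteq> 0"
    and "m \<noteq> 0"
  shows "derivation scale f \<longleftrightarrow>
    (\<forall>x y. scale l (f (x + y) - f x - f y)
         + scale m (f (x * y) - scale x (f y) - scale y (f x)) = 0)"
proof -
  interpret vector_space scale by fact
  show ?thesis
  proof
    assume "derivation scale f"
    then show "\<forall>x y. scale l (f (x + y) - f x - f y)
         + scale m (f (x * y) - scale x (f y) - scale y (f x)) = 0"
      by (simp add: derivation_def)
  next
    assume eq: "\<forall>x y. scale l (f (x + y) - f x - f y)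
         + scale m (f (x * y) - scale x (f y) - scale y (f x)) = 0"
    have E: "f (x + y) - f x - f y
        + scale (m / l) (f (x * y) - scale x (f y) - scale y (f x)) = 0" for x y
    proof -
      have "scale (inverse l) (scale l (f (x + y) - f x - f y)
          + scale m (f (x * y) - scale x (f y) - scale y (f x))) = 0"
        using eq by simp
      then show ?thesis
        using \<open>l \<noteq> 0\<close> by (simp only: scale_right_distrib scale_scale) (simp add: field_simps)
    qed
    have add: "f (x + y) = f x + f y" for x y
      using mixed_equation_additive[of "m / l" f, OF _ E] \<open>l \<noteq> 0\<close> \<open>m \<noteq> 0\<close> by simp
    have "f (x * y) = scale x (f y) + scale y (f x)" for x y
      using eq[rule_format, of x y] \<open>m \<noteq> 0\<close> by (simp add: add diff_diff_add)
    with add show "derivation scale f"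
      by (simp add: derivation_def)
  qed
qed

end
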